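(* The Smyth power space of a quasisober space (respectively cut space, weakly sober space) is not always quasisober (respectively a cut space, weakly sober). That is: (i) there exists a quasisober space $X$ such that $P^s(X)$ is not quasisober; (ii) there exists a cut space $X$ such that $P^s(X)$ is not a cut space; (iii) there exists a weakly sober space $X$ such that $P^s(X)$ is not weakly sober.
   Context: For a topological space $X$, the specialization preorder is $x\le y$ iff $x\in\mathrm{cl}\{y\}$; all order-theoretic notions in $X$ refer to it. For $A\subseteq X$, $A^{\uparrow}$ and $A^{\downarrow}$ denote the sets of all upper, respectively lower, bounds of $A$ in $X$, and $A^{\delta}=(A^{\uparrow})^{\downarrow}$ is the cut closure of $A$; $A$ is a cut if $A=A^{\delta}$. Directed sets and irreducible closed sets are nonempty. $X$ is a cut space if $\mathrm{cl}\,D=D^{\delta}$ for every directed subset $D$ of $X$. $X$ is weakly sober if it is $T_0$ and every irreducible closed subset $A$ of $X$ is a cut. $X$ is quasisober if it is $T_0$ and every irreducible closed subset of $X$ equals $D^{\delta}$ for some directed subset $D$ of $X$. The Smyth power space $P^s(X)$ is the set $K(X)$ of nonempty compact saturated subsets of $X$ (saturated = intersection of open sets, equivalently an upper set), with the upper Vietoris topology generated by the sets $\Box U=\{K\in K(X):K\subseteq U\}$, $U$ open in $X$; its specialization order is reverse inclusion. *)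

theory Defs
  imports "HOL-Analysis.Analysis"
begin

definition specializes :: "'a topology \<Rightarrow> 'a \<Rightarrow> 'a \<Rightarrow> bool" where
  "specializes X x y \<longleftrightarrow> x \<in> X closure_of {y}"

definition upper_bounds :: "'a topology \<Rightarrow> 'a set \<Rightarrow> 'a set" where
  "upper_bounds X A = {u \<in> topspace X. \<forall>a\<in>A. specializes X a u}"

definition lower_bounds :: "'a topology \<Rightarrow> 'a set \<Rightarrow> 'a set" where
  "lower_bounds X A = {l \<in> topspace X. \<forall>a\<in>A. specializes X l a}"

definition cut_closure :: "'a topology \<Rightarrow> 'a set \<Rightarrow> 'a set" where
  "cut_closure X A = lower_bounds X (upper_bounds X A)"

definition is_cut :: "'a topology \<Rightarrow> 'a set \<Rightarrow> bool" where
  "is_cut X A \<longleftrightarrow> A \<subseteq> topspace X \<and> A = cut_closure X A"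

definition directed_in :: "'a topology \<Rightarrow> 'a set \<Rightarrow> bool" where
  "directed_in X D \<longleftrightarrow> D \<subseteq> topspace X \<and> D \<noteq> {} \<and>
     (\<forall>x\<in>D. \<forall>y\<in>D. \<exists>z\<in>D. specializes X x z \<and> specializes X y z)"

definition irreducible_closedin :: "'a topology \<Rightarrow> 'a set \<Rightarrow> bool" where
  "irreducible_closedin X A \<longleftrightarrow> closedin X A \<and> A \<noteq> {} \<and>
     (\<forall>B C. closedin X B \<and> closedin X C \<and> A \<subseteq> B \<union> C \<longrightarrow> A \<subseteq> B \<or> A \<subseteq> C)"

definition cut_space :: "'a topology \<Rightarrow> bool" where
  "cut_space X \<longleftrightarrow> (\<forall>D. directed_in X D \<longrightarrow> X closure_of D = cut_closure X D)"

definition weakly_sober :: "'a topology \<Rightarrow> bool" where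
  "weakly_sober X \<longleftrightarrow> t0_space X \<and> (\<forall>A. irreducible_closedin X A \<longrightarrow> is_cut X A)"

definition quasisober :: "'a topology \<Rightarrow> bool" where
  "quasisober X \<longleftrightarrow> t0_space X \<and>
     (\<forall>A. irreducible_closedin X A \<longrightarrow> (\<exists>D. directed_in X D \<and> A = cut_closure X D))"

(* Intersecting with topspace X makes the empty family yield the whole space. *)
definition saturated_in :: "'a topology \<Rightarrow> 'a set \<Rightarrow> bool" where
  "saturated_in X A \<longleftrightarrow> (\<exists>\<U>. (\<forall>U\<in>\<U>. openin X U) \<and> A = topspace X \<inter> \<Inter>\<U>)"

definition compact_saturated_sets :: "'a topology \<Rightarrow> 'a set set" where
  "compact_saturated_sets X = {K. K \<noteq> {} \<and> compactin X K \<and> saturated_in X K}"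

definition smyth_box :: "'a topology \<Rightarrow> 'a set \<Rightarrow> 'a set set" where
  "smyth_box X U = {K \<in> compact_saturated_sets X. K \<subseteq> U}"

definition smyth_power_space :: "'a topology \<Rightarrow> 'a set topology" where
  "smyth_power_space X = topology_generated_by {smyth_box X U | U. openin X U}"

lemma topspace_smyth_power_space:
  "topspace (smyth_power_space X) = compact_saturated_sets X"
proof -
  have "smyth_box X (topspace X) = compact_saturated_sets X"
    by (auto simp: smyth_box_def compact_saturated_sets_def dest: compactin_subset_topspace)
  moreover have "smyth_box X U \<subseteq> compact_saturated_sets X" for U
    by (auto simp: smyth_box_def)
  ultimately show ?thesis
    unfolding smyth_power_space_def topology_generated_by_topspace
    using openin_topspace by blast
qed

lemma specializes_smyth_power_space:
  "specializes (smyth_power_space X) K L \<longleftrightarrow>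
     K \<in> compact_saturated_sets X \<and> L \<in> compact_saturated_sets X \<and> L \<subseteq> K"
proof
  assume "specializes (smyth_power_space X) K L"
  then have K: "K \<in> compact_saturated_sets X"
    and cl: "\<And>T. openin (smyth_power_space X) T \<Longrightarrow> K \<in> T \<Longrightarrow> L \<in> T"
    by (auto simp: specializes_def in_closure_of topspace_smyth_power_space)
  have box: "L \<in> smyth_box X U" if "openin X U" "K \<subseteq> U" for U
  proof (rule cl)
    show "openin (smyth_power_space X) (smyth_box X U)"
      unfolding smyth_power_space_def using that by (intro topology_generated_by_Basis) blast
    show "K \<in> smyth_box X U" using K that by (simp add: smyth_box_def)
  qed
  have "K \<subseteq> topspace X"
    using K by (auto simp: compact_saturated_sets_def dest: compactin_subset_topspace)
  then have L: "L \<in> compact_saturated_sets X" "L \<subseteq> topspace X"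
    using box[OF openin_topspace] by (auto simp: smyth_box_def)
  obtain \<U> where U: "\<forall>U\<in>\<U>. openin X U" "K = topspace X \<inter> \<Inter>\<U>"
    using K by (auto simp: compact_saturated_sets_def saturated_in_def)
  have "L \<subseteq> U" if "U \<in> \<U>" for U
    using box[of U] U that by (auto simp: smyth_box_def)
  then show "K \<in> compact_saturated_sets X \<and> L \<in> compact_saturated_sets X \<and> L \<subseteq> K"
    using K L U by blast
next
  assume *: "K \<in> compact_saturated_sets X \<and> L \<in> compact_saturated_sets X \<and> L \<subseteq> K"
  have "L \<in> T" if "generate_topology_on {smyth_box X U | U. openin X U} T" "K \<in> T" for T
    using that by (induction rule: generate_topology_on.induct) (use * in \<open>auto simp: smyth_box_def\<close>)
  then show "specializes (smyth_power_space X) K L"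
    using * by (auto simp: specializes_def in_closure_of topspace_smyth_power_space)
      (simp add: smyth_power_space_def openin_topology_generated_by_iff)
qed

end

(* One space serves for all three parts. Let X be the chain of natural numbers with two incomparable
   upper bounds added on top, with the upper sets as open sets. Its irreducible closed sets are the
   directed lower sets, and each of these is a cut: the chain itself consists of all common lower
   bounds of the two maximal points. In the Smyth power space the principal filters of the chain
   elements form a directed family whose upper bounds are the nonempty subsets of the set M of the
   two maximal points, so M lies in its cut closure; but M is open and contains none of these filters,
   so M does not lie in the topological closure. Hence the power space is not a cut space. This
   suffices because every quasisober space is weakly sober and every weakly sober space is a cut
   space. *)

theory Submission
  imports Defs
begin

lemma specializes_in_closedin:
  assumes "specializes X x y" "closedin X C" "y \<in> C"
  shows "x \<in> C"
  using assms closure_of_minimal[of "{y}" C X] by (auto simp: specializes_def)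

text \<open>The points below \<open>u\<close> form the closed set \<open>X closure_of {u}\<close>,
  which contains \<open>D\<close> exactly when it contains the closure. Hence \<open>D\<close> and
  its closure have the same cut closure.\<close>

lemma upper_bounds_closure_of:
  assumes "D \<subseteq> topspace X"
  shows "upper_bounds X (X closure_of D) = upper_bounds X D"
proof
  show "upper_bounds X (X closure_of D) \<subseteq> upper_bounds X D"
    using closure_of_subset[OF assms] by (auto simp: upper_bounds_def)
  show "upper_bounds X D \<subseteq> upper_bounds X (X closure_of D)"
  proof
    fix u assume u: "u \<in> upper_bounds X D"
    then have "D \<subseteq> X closure_of {u}"
      by (auto simp: upper_bounds_def specializes_def)
    then have "X closure_of D \<subseteq> X closure_of {u}"
      by (simp add: closure_of_minimal)
    with u show "u \<in> upper_bounds X (X closure_of D)"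
      by (auto simp: upper_bounds_def specializes_def)
  qed
qed

lemma cut_closure_extensive:
  assumes "A \<subseteq> topspace X"
  shows "A \<subseteq> cut_closure X A"
  using assms by (auto simp: cut_closure_def lower_bounds_def upper_bounds_def)

text \<open>Upper and lower bounds form a Galois connection, so lower-upper-lower collapses to
  lower.\<close>

lemma is_cut_cut_closure: "is_cut X (cut_closure X A)"
proof -
  have "lower_bounds X (upper_bounds X (lower_bounds X B)) = lower_bounds X B"
    if "B \<subseteq> topspace X" for B
    using that by (auto simp: lower_bounds_def upper_bounds_def)
  moreover have "upper_bounds X A \<subseteq> topspace X"
    by (auto simp: upper_bounds_def)
  ultimately show ?thesis
    by (auto simp: is_cut_def cut_closure_def lower_bounds_def)
qed

text \<open>Closed sets are lower sets: if \<open>x\<close> in \<open>D\<close> avoids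
  \<open>B\<close> and \<open>y\<close> in \<open>D\<close> avoids \<open>C\<close>, a common upper
  bound of both in \<open>D\<close> avoids \<open>B\<close> and \<open>C\<close> alike.\<close>

lemma directed_in_imp_irreducible_closedin_closure_of:
  assumes "directed_in X D"
  shows "irreducible_closedin X (X closure_of D)"
proof -
  have D: "D \<subseteq> topspace X" "D \<noteq> {}"
    and dir: "\<And>x y. x \<in> D \<Longrightarrow> y \<in> D \<Longrightarrow> \<exists>z\<in>D. specializes X x z \<and> specializes X y z"
    using assms by (auto simp: directed_in_def)
  have sub: "D \<subseteq> X closure_of D"
    using D by (simp add: closure_of_subset)
  have "X closure_of D \<subseteq> B \<or> X closure_of D \<subseteq> C"
    if B: "closedin X B" and C: "closedin X C" and cover: "X closure_of D \<subseteq> B \<union> C" for B C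
  proof -
    have "D \<subseteq> B \<or> D \<subseteq> C"
    proof (rule ccontr)
      assume "\<not> (D \<subseteq> B \<or> D \<subseteq> C)"
      then obtain x y where "x \<in> D" "x \<notin> B" "y \<in> D" "y \<notin> C"
        by blast
      then obtain z where "z \<in> D" "z \<notin> B" "z \<notin> C"
        using dir specializes_in_closedin B C by metis
      then show False
        using cover sub by blast
    qed
    then show ?thesis
      using B C closure_of_minimal by metis
  qed
  then show ?thesis
    using D sub by (auto simp: irreducible_closedin_def)
qed

lemma quasisober_imp_weakly_sober: "quasisober X \<Longrightarrow> weakly_sober X"
  unfolding quasisober_def weakly_sober_def using is_cut_cut_closure by metis

lemma weakly_sober_imp_cut_space:
  assumes "weakly_sober X"
  shows "cut_space X"
  unfolding cut_space_def
proof (intro allI impI)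
  fix D assume D: "directed_in X D"
  then have "is_cut X (X closure_of D)"
    using assms directed_in_imp_irreducible_closedin_closure_of
    by (auto simp: weakly_sober_def)
  moreover have "D \<subseteq> topspace X"
    using D by (simp add: directed_in_def)
  ultimately show "X closure_of D = cut_closure X D"
    by (simp add: is_cut_def cut_closure_def upper_bounds_closure_of)
qed

lemma openin_imp_saturated_in: "openin X U \<Longrightarrow> saturated_in X U"
  unfolding saturated_in_def using openin_subset[of X U] by (intro exI[of _ "{U}"]) auto

text \<open>The chain is \<open>2, 3, \<dots>\<close>; its two incomparable upper bounds are \<open>0\<close> and \<open>1\<close>.\<close>

definition fork_le :: "nat \<Rightarrow> nat \<Rightarrow> bool" where
  "fork_le x y \<longleftrightarrow> x = y \<or> 2 \<le> x \<and> (y < 2 \<or> x \<le> y)"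

definition fork_space :: "nat topology" where
  "fork_space = topology (\<lambda>U. \<forall>x\<in>U. \<forall>y. fork_le x y \<longrightarrow> y \<in> U)"

lemma fork_le_refl: "fork_le x x"
  by (simp add: fork_le_def)

lemma fork_le_trans: "fork_le x y \<Longrightarrow> fork_le y z \<Longrightarrow> fork_le x z"
  by (auto simp: fork_le_def)

lemma fork_le_antisym: "fork_le x y \<Longrightarrow> fork_le y x \<Longrightarrow> x = y"
  by (auto simp: fork_le_def)

lemma openin_fork_space: "openin fork_space U \<longleftrightarrow> (\<forall>x\<in>U. \<forall>y. fork_le x y \<longrightarrow> y \<in> U)"
proof -
  have "istopology (\<lambda>U. \<forall>x\<in>U. \<forall>y. fork_le x y \<longrightarrow> y \<in> U)"
    unfolding istopology_def by blast
  then show ?thesis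
    by (simp add: fork_space_def)
qed

lemma topspace_fork_space: "topspace fork_space = UNIV"
  using openin_subset[of fork_space UNIV] by (auto simp: openin_fork_space)

lemma closedin_fork_space: "closedin fork_space C \<longleftrightarrow> (\<forall>y\<in>C. \<forall>x. fork_le x y \<longrightarrow> x \<in> C)"
  by (auto simp: closedin_def topspace_fork_space openin_fork_space)

lemma openin_fork_filter: "openin fork_space {y. fork_le x y}"
  using fork_le_trans by (auto simp: openin_fork_space)

lemma specializes_fork_space: "specializes fork_space x y \<longleftrightarrow> fork_le x y"
proof
  assume "specializes fork_space x y"
  then show "fork_le x y"
    using openin_fork_filter[of x] fork_le_refl[of x]
    by (auto simp: specializes_def in_closure_of)
next
  assume "fork_le x y"
  then show "specializes fork_space x y"
    by (auto simp: specializes_def in_closure_of topspace_fork_space openin_fork_space)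
qed

text \<open>Complements of principal filters are closed. If \<open>x\<close> and \<open>y\<close>
  had no common upper bound in \<open>A\<close>, the complements of their filters would cover
  \<open>A\<close>, yet each omits one of the two points.\<close>

lemma irreducible_closedin_fork_space_imp_directed_in:
  assumes "irreducible_closedin fork_space A"
  shows "directed_in fork_space A"
proof -
  have "\<exists>z\<in>A. fork_le x z \<and> fork_le y z" if "x \<in> A" "y \<in> A" for x y
  proof (rule ccontr)
    assume "\<not> (\<exists>z\<in>A. fork_le x z \<and> fork_le y z)"
    then have cover: "A \<subseteq> {z. \<not> fork_le x z} \<union> {z. \<not> fork_le y z}"
      by blast
    have "closedin fork_space {z. \<not> fork_le w z}" for w
      using fork_le_trans by (auto simp: closedin_fork_space)
    then have "A \<subseteq> {z. \<not> fork_le x z} \<or> A \<subseteq> {z. \<not> fork_le y z}"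
      using assms cover unfolding irreducible_closedin_def by blast
    then show False
      using that fork_le_refl by blast
  qed
  then show ?thesis
    using assms
    by (auto simp: directed_in_def irreducible_closedin_def topspace_fork_space specializes_fork_space)
qed

lemma cut_closure_fork_space:
  assumes dir: "directed_in fork_space A" and closed: "closedin fork_space A"
  shows "cut_closure fork_space A = A"
proof
  show "A \<subseteq> cut_closure fork_space A"
    by (simp add: cut_closure_extensive topspace_fork_space)
  show "cut_closure fork_space A \<subseteq> A"
  proof
    fix x assume "x \<in> cut_closure fork_space A"
    then have x: "fork_le x u" if "\<forall>a\<in>A. fork_le a u" for u
      using that by (auto simp: cut_closure_def lower_bounds_def upper_bounds_def
          topspace_fork_space specializes_fork_space)
    have lower: "w \<in> A" if "fork_le w y" "y \<in> A" for w y
      using closed that by (auto simp: closedin_fork_space)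
    have dirA: "\<exists>z\<in>A. fork_le y z \<and> fork_le w z" if "y \<in> A" "w \<in> A" for y w
      using dir that by (auto simp: directed_in_def specializes_fork_space)
    show "x \<in> A"
    proof (cases "\<exists>m\<in>A. m < 2")
      case True
      then obtain m where m: "m \<in> A" "m < 2"
        by blast
      \<comment> \<open>\<open>m\<close> is maximal, so directedness makes it the greatest element
        of \<open>A\<close>.\<close>
      have "fork_le a m" if "a \<in> A" for a
        using dirA[OF m(1) that] m(2) by (auto simp: fork_le_def)
      then show ?thesis
        using x m(1) lower by blast
    next
      case False
      then have chain: "2 \<le> a" if "a \<in> A" for a
        using that by force
      then have "\<forall>a\<in>A. fork_le a 0" "\<forall>a\<in>A. fork_le a 1"
        by (auto simp: fork_le_def)
      then have "fork_le x 0" "fork_le x 1"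
        by (simp_all only: x)
      \<comment> \<open>Only chain elements lie below both incomparable maximal points.\<close>
      then have "2 \<le> x"
        by (auto simp: fork_le_def)
      show ?thesis
      proof (rule ccontr)
        assume "x \<notin> A"
        have below: "a < x" if "a \<in> A" for a
          using lower[of x a] that \<open>x \<notin> A\<close> \<open>2 \<le> x\<close> by (force simp: fork_le_def)
        \<comment> \<open>All of \<open>A\<close> lies strictly below \<open>x\<close> in the chain,
          so the predecessor of \<open>x\<close> already bounds \<open>A\<close>.\<close>
        then have "fork_le x (x - 1)"
          using chain by (intro x) (force simp: fork_le_def)
        moreover obtain a where "a \<in> A"
          using dir by (auto simp: directed_in_def)
        \<comment> \<open>This keeps \<open>x - 1\<close> inside the chain; for \<open>x = 2\<close>
          it would be the maximal point 1, which does lie above \<open>x\<close>.\<close>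
        then have "3 \<le> x"
          using chain[of a] below[of a] by linarith
        ultimately show False
          by (auto simp: fork_le_def)
      qed
    qed
  qed
qed

lemma quasisober_fork_space: "quasisober fork_space"
  unfolding quasisober_def
proof (intro conjI allI impI)
  show "t0_space fork_space"
    unfolding t0_space_def topspace_fork_space
    using openin_fork_filter fork_le_refl fork_le_antisym by (metis mem_Collect_eq)
  show "\<exists>D. directed_in fork_space D \<and> A = cut_closure fork_space D"
    if "irreducible_closedin fork_space A" for A
    using that irreducible_closedin_fork_space_imp_directed_in cut_closure_fork_space
    by (metis irreducible_closedin_def)
qed

text \<open>Any open set containing \<open>x\<close> contains its whole filter, so a single member
  of a cover suffices.\<close>

lemma fork_filter_in_compact_saturated_sets:
  "{y. fork_le x y} \<in> compact_saturated_sets fork_space"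
proof -
  have "compactin fork_space {y. fork_le x y}"
    unfolding compactin_def
  proof (intro conjI allI impI)
    fix \<U> assume \<U>: "Ball \<U> (openin fork_space) \<and> {y. fork_le x y} \<subseteq> \<Union>\<U>"
    have "x \<in> {y. fork_le x y}"
      by (simp add: fork_le_refl)
    with \<U> obtain U where U: "U \<in> \<U>" "x \<in> U"
      by blast
    with \<U> have "openin fork_space U"
      by blast
    with U have "{y. fork_le x y} \<subseteq> U"
      unfolding openin_fork_space by blast
    with U show "\<exists>\<F>. finite \<F> \<and> \<F> \<subseteq> \<U> \<and> {y. fork_le x y} \<subseteq> \<Union>\<F>"
      by (intro exI[of _ "{U}"]) simp
  qed (simp add: topspace_fork_space)
  moreover have "{y. fork_le x y} \<noteq> {}"
    using fork_le_refl by blast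
  ultimately show ?thesis
    by (simp add: compact_saturated_sets_def openin_fork_filter openin_imp_saturated_in)
qed

lemma not_cut_space_smyth_fork_space: "\<not> cut_space (smyth_power_space fork_space)"
proof
  let ?P = "smyth_power_space fork_space"
  let ?F = "\<lambda>n. {y. fork_le n y}"
  let ?M = "{0, 1} :: nat set"
  let ?D = "?F ` {2..}"
  assume cut: "cut_space ?P"
  have M_open: "openin fork_space ?M"
    by (auto simp: openin_fork_space fork_le_def)
  have "compactin fork_space ?M"
    by (simp add: finite_imp_compactin topspace_fork_space)
  then have M: "?M \<in> compact_saturated_sets fork_space"
    using M_open openin_imp_saturated_in by (simp add: compact_saturated_sets_def)
  have "directed_in ?P ?D"
    unfolding directed_in_def
  proof (intro conjI ballI)
    show "?D \<subseteq> topspace ?P"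
      using fork_filter_in_compact_saturated_sets by (auto simp: topspace_smyth_power_space)
    show "?D \<noteq> {}"
      by auto
    fix K L assume "K \<in> ?D" "L \<in> ?D"
    \<comment> \<open>The order is reverse inclusion, so the smaller filter at the larger index is
      the upper bound.\<close>
    then obtain m n where mn: "2 \<le> m" "K = ?F m" "2 \<le> n" "L = ?F n"
      by auto
    then have "?F (max m n) \<subseteq> K" "?F (max m n) \<subseteq> L"
      by (auto simp: fork_le_def)
    then show "\<exists>z\<in>?D. specializes ?P K z \<and> specializes ?P L z"
      using mn fork_filter_in_compact_saturated_sets
      by (intro bexI[of _ "?F (max m n)"]) (auto simp: specializes_smyth_power_space)
  qed
  then have cl: "?P closure_of ?D = cut_closure ?P ?D"
    using cut by (simp add: cut_space_def)
  have "K \<subseteq> ?M" if "\<forall>n\<ge>2. K \<subseteq> ?F n" for K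
  proof
    fix k assume "k \<in> K"
    \<comment> \<open>The index \<open>k + 2\<close> is in the chain and numerically exceeds
      \<open>k\<close>, so only a maximal \<open>k\<close> can lie above it.\<close>
    moreover have "K \<subseteq> ?F (k + 2)"
      using that by simp
    ultimately have "fork_le (k + 2) k"
      by blast
    then show "k \<in> ?M"
      by (auto simp: fork_le_def)
  qed
  then have "?M \<in> cut_closure ?P ?D"
    using M by (auto simp: cut_closure_def lower_bounds_def upper_bounds_def
        topspace_smyth_power_space specializes_smyth_power_space)
  moreover have "openin ?P (smyth_box fork_space ?M)"
    unfolding smyth_power_space_def using M_open by (intro topology_generated_by_Basis) blast
  moreover have "?M \<in> smyth_box fork_space ?M"
    using M by (simp add: smyth_box_def)
  ultimately obtain n where "2 \<le> n" "?F n \<in> smyth_box fork_space ?M"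
    unfolding cl[symmetric] in_closure_of by blast
  then have "?F n \<subseteq> ?M"
    by (simp add: smyth_box_def)
  moreover have "n \<in> ?F n"
    by (simp add: fork_le_refl)
  ultimately have "n \<in> ?M"
    by blast
  with \<open>2 \<le> n\<close> show False
    by auto
qed

theorem mainTheorem13:
  shows "(\<exists>X :: nat topology. quasisober X \<and> \<not> quasisober (smyth_power_space X)) \<and>
         (\<exists>X :: nat topology. cut_space X \<and> \<not> cut_space (smyth_power_space X)) \<and>
         (\<exists>X :: nat topology. weakly_sober X \<and> \<not> weakly_sober (smyth_power_space X))"
  \<comment> \<open>The implications carry the strongest property down for \<open>fork_space\<close>
    and, by contraposition, the failure up for its power space.\<close>
  using quasisober_fork_space not_cut_space_smyth_fork_space
    quasisober_imp_weakly_sober weakly_sober_imp_cut_space by meson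

end
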